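(* Define sequences $(a_n),(b_n),(c_n),(d_n),(e_n),(f_n)$, $n\ge 0$, by the power series expansions $$\frac{(q^6, q^{20};q^{26})_\infty}{(q^7, q^{19}; q^{26})_\infty}= \sum_{n=0}^{\infty}a_n q^n,\qquad \frac{(q^8, q^{18} ;q^{26})_\infty}{(q^5, q^{21}; q^{26})_\infty}= \sum_{n=0}^{\infty}b_n q^n,$$ $$\frac{(q^4, q^{22};q^{26})_\infty}{(q^9, q^{17}; q^{26})_\infty}= \sum_{n=0}^{\infty}c_n q^n,\qquad \frac{(q^{10}, q^{16} ;q^{26})_\infty}{(q^3, q^{23}; q^{26})_\infty}= \sum_{n=0}^{\infty}d_n q^n,$$ $$\frac{(q^2, q^{24};q^{26})_\infty}{(q^{11}, q^{15}; q^{26})_\infty}= \sum_{n=0}^{\infty}e_n q^n,\qquad \frac{(q^{12}, q^{14} ;q^{26})_\infty}{(q, q^{25}; q^{26})_\infty}= \sum_{n=0}^{\infty}f_n q^n.$$ Then for every integer $n\ge 0$: (i) $a_{13n+11}=0$; (ii) $b_{13n+11}=0$; (iii) $c_{13n+7}=0$; (iv) $d_{13n+7}=0$; (v) $e_{13n+12}=0$; (vi) $f_{13n+12}=0$.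
   Context: For $|q|<1$, $(\lambda;q)_\infty=\prod_{j=0}^{\infty}(1-\lambda q^j)$, and $(\lambda_1,\lambda_2;q)_\infty=(\lambda_1;q)_\infty(\lambda_2;q)_\infty$; for example $(q^6,q^{20};q^{26})_\infty=\prod_{j\ge 0}(1-q^{6+26j})(1-q^{20+26j})$. The products may be read as formal power series in $q$ or as analytic functions on $|q|<1$. *)

theory Defs
  imports "HOL-Analysis.Analysis"
begin

text \<open>
  At type \<open>complex fps\<close> the infinite product is taken in the topology of formal power series, where
  convergence means that every coefficient is eventually constant.
\<close>

definition qpoch_inf :: "'a::{t2_space, comm_ring_1} \<Rightarrow> 'a \<Rightarrow> 'a" where
  "qpoch_inf x q = (\<Prod>j. 1 - x * q ^ j)"

definition qpoch_inf2 :: "'a::{t2_space, comm_ring_1} \<Rightarrow> 'a \<Rightarrow> 'a \<Rightarrow> 'a" where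
  "qpoch_inf2 x y q = qpoch_inf x q * qpoch_inf y q"

text \<open>
  The following two facts show that the products used here converge and that their constant
  coefficient is 1, so that division by them is multiplication by the inverse power series.
\<close>

lemma has_prod_qpoch_inf_fps_X:
  assumes "r > 0" "m > 0"
  shows "(\<lambda>j. 1 - fps_X ^ r * (fps_X ^ m) ^ j :: complex fps) has_prod
           qpoch_inf (fps_X ^ r) (fps_X ^ m)"
    and "fps_nth (qpoch_inf (fps_X ^ r) (fps_X ^ m) :: complex fps) 0 = 1"
proof -
  define f :: "nat \<Rightarrow> complex fps" where "f = (\<lambda>j. 1 - fps_X ^ r * (fps_X ^ m) ^ j)"
  define P where "P = (\<lambda>n. \<Prod>i\<le>n. f i)"
  define L where "L = Abs_fps (\<lambda>N. fps_nth (P N) N)"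
  have step: "fps_nth (P (Suc n)) N = fps_nth (P n) N" if "N \<le> n" for n N
  proof -
    have "n < m * Suc n"
      using assms(2) by (cases m) auto
    hence "N < r + m * Suc n"
      using that by simp
    moreover have "P (Suc n) = P n - fps_X ^ (r + m * Suc n) * P n"
      by (simp add: P_def f_def power_add power_mult algebra_simps)
    ultimately show ?thesis
      by (simp only: fps_sub_nth fps_X_power_mult_nth if_True diff_zero)
  qed
  have stable: "fps_nth (P n) N = fps_nth L N" if "N \<le> n" for n N
    using that by (induction n rule: dec_induct) (auto simp: L_def step)
  have lim: "P \<longlonglongrightarrow> L"
    by (rule tendsto_fpsI) (auto intro: eventually_sequentiallyI stable)
  have L0: "fps_nth L 0 = 1"
    using assms by (simp add: L_def P_def f_def)
  have "f has_prod L"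
    using lim L0 by (auto simp: has_prod_def raw_has_prod_def P_def)
  moreover from this have "L = qpoch_inf (fps_X ^ r) (fps_X ^ m)"
    unfolding qpoch_inf_def f_def by (rule has_prod_unique)
  ultimately show "(\<lambda>j. 1 - fps_X ^ r * (fps_X ^ m) ^ j :: complex fps) has_prod
           qpoch_inf (fps_X ^ r) (fps_X ^ m)"
    and "fps_nth (qpoch_inf (fps_X ^ r) (fps_X ^ m) :: complex fps) 0 = 1"
    using L0 by (simp_all add: f_def)
qed

end

theory Submission
  imports Defs "HOL-Computational_Algebra.Formal_Laurent_Series" "HOL-Number_Theory.Cong"
begin

text \<open>
  All six quotients have the form
  \<open>(q^d, q^(b+M); q^(2M)) / (q^b, q^(M+d); q^(2M))\<close> with \<open>M = 13\<close>, \<open>b\<close> odd and \<open>b + d = M\<close>.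
  Put \<open>z = q^b\<close>, \<open>y = q^d\<close> and \<open>x = z y = q^M\<close>. With \<open>\<theta>(t) = (t, x^2 / t; x^2)\<close> the quotient is
  \<open>\<theta>(z x) / \<theta>(z)\<close>, and Ramanujan's summation of the bilateral series \<open>\<^sub>1\<psi>\<^sub>1\<close> gives it as
  \[ W \cdot \sum_{k \ge 0} x^k \left( \frac{1}{1 - z x^{2k}} - \frac{y}{1 - y x^{2k+1}} \right),
     \qquad W = \frac{(x; x^2)_\infty^2}{(x^2; x^2)_\infty^2} . \]
  The factor \<open>W\<close> is a power series in \<open>x = q^M\<close>, so multiplying by it does not mix residue classes of
  exponents modulo \<open>M\<close>, and it suffices that the sum has no exponents in the claimed class.
  Expanding the geometric series, its two halves enumerate the exponents
  \<open>M k + (b + 2 M k) m\<close> and \<open>M k + d + (d + M (2 k + 1)) m\<close> with \<open>k, m \<ge> 0\<close>.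
  Write \<open>b = 2 u + 1\<close>. In the class of \<open>b (u + d)\<close> the first kind forces \<open>m = M l + u + d\<close>
  and the second forces \<open>m = M l + u\<close>. After these substitutions each kind of exponent is a quadratic polynomial in
  \<open>(k, l)\<close>, and one polynomial becomes the other when \<open>k\<close> and \<open>l\<close> are exchanged
  (\<open>swap_exponents\<close>). So the two halves cancel in this class.

  The summation formula is reached through a finite form: the partial fraction decomposition in \<open>z\<close> of the
  truncated quotient (\<open>prod_partial_fractions\<close>, \<open>finite_bilateral_sum\<close>). The limit is taken coefficientwise
  in the ring of formal power series (\<open>nth_bilateral_sum\<close>).
\<close>

section \<open>A finite form of the bilateral summation\<close>

text \<open>
  The step of the induction multiplies the decomposition by one more factor \<open>(w - b s) / (w - a s)\<close>. The residue at
  the new pole is \<open>a s - b s\<close> times the value at \<open>a s\<close> of the product so far, which the induction hypothesis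
  turns back into a sum because it holds for every \<open>w\<close> off the poles.
\<close>

lemma prod_partial_fractions:
  fixes a b :: "'i \<Rightarrow> 'a::field"
  assumes "finite I" "inj_on a I" "w \<notin> a ` I"
  shows "(\<Prod>j\<in>I. (w - b j) / (w - a j)) =
           1 + (\<Sum>i\<in>I. (\<Prod>j\<in>I. a i - b j) / (\<Prod>j\<in>I - {i}. a i - a j) / (w - a i))"
  using assms
proof (induction I arbitrary: w rule: finite_induct)
  case empty
  then show ?case by simp
next
  case (insert s I w)
  define A where "A = (\<lambda>i. (\<Prod>j\<in>I. a i - b j) / (\<Prod>j\<in>I - {i}. a i - a j))"
  have IH: "(\<Prod>j\<in>I. (v - b j) / (v - a j)) = 1 + (\<Sum>i\<in>I. A i / (v - a i))"
    if "v \<notin> a ` I" for v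
    unfolding A_def using insert that by (intro insert.IH) auto
  have as: "a s \<notin> a ` I" and ws: "w \<noteq> a s" and wI: "w \<notin> a ` I"
    using insert.prems insert.hyps by auto
  have ne: "a s \<noteq> a i" "a i \<noteq> a s" "w \<noteq> a i" if "i \<in> I" for i
    using as wI imageI[OF that, of a] by (metis, metis, metis)
  have new: "(\<Prod>j\<in>insert s I. a i - b j) / (\<Prod>j\<in>insert s I - {i}. a i - a j)
      = A i * ((a i - b s) / (a i - a s))" if "i \<in> I" for i
  proof -
    have "insert s I - {i} = insert s (I - {i})" "s \<notin> I - {i}"
      using that insert.hyps by auto
    thus ?thesis using insert.hyps by (simp add: A_def mult_ac)
  qed
  have news: "(\<Prod>j\<in>insert s I. a s - b j) / (\<Prod>j\<in>insert s I - {s}. a s - a j)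
      = (a s - b s) * (1 + (\<Sum>i\<in>I. A i / (a s - a i)))"
  proof -
    have "insert s I - {s} = I" using insert.hyps by auto
    thus ?thesis using insert.hyps IH[OF as]
      by (simp add: prod_dividef flip: times_divide_eq_right)
  qed
  \<comment> \<open>partial fractions with the two poles \<open>a s\<close> and \<open>a i\<close>\<close>
  have split: "(w - b s) / (w - a s) * (A i / (w - a i))
      = A i * ((a i - b s) / (a i - a s)) / (w - a i)
        + (a s - b s) / (w - a s) * (A i / (a s - a i))" if "i \<in> I" for i
  proof -
    have "w - a s \<noteq> 0" "w - a i \<noteq> 0" "a s - a i \<noteq> 0" "a i - a s \<noteq> 0"
      using ne[OF that] ws by auto
    moreover from this have "(w - b s) / ((w - a s) * (w - a i))
      = (a i - b s) / ((a i - a s) * (w - a i)) + (a s - b s) / ((w - a s) * (a s - a i))"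
      by (simp add: divide_simps) (simp add: algebra_simps)
    hence "A i * ((w - b s) / ((w - a s) * (w - a i)))
      = A i * ((a i - b s) / ((a i - a s) * (w - a i)) + (a s - b s) / ((w - a s) * (a s - a i)))"
      by simp
    thus ?thesis by (simp add: distrib_left mult_ac)
  qed
  have "(\<Prod>j\<in>insert s I. (w - b j) / (w - a j))
      = (w - b s) / (w - a s) * (1 + (\<Sum>i\<in>I. A i / (w - a i)))"
    using insert.hyps IH[OF wI] by simp
  also have "\<dots> = (w - b s) / (w - a s) + (\<Sum>i\<in>I. (w - b s) / (w - a s) * (A i / (w - a i)))"
    by (simp add: distrib_left sum_distrib_left)
  also have "(\<Sum>i\<in>I. (w - b s) / (w - a s) * (A i / (w - a i)))
     = (\<Sum>i\<in>I. A i * ((a i - b s) / (a i - a s)) / (w - a i))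
        + (a s - b s) / (w - a s) * (\<Sum>i\<in>I. A i / (a s - a i))"
    by (simp only: split sum.distrib sum_distrib_left cong: sum.cong)
  also have "(w - b s) / (w - a s) = 1 + (a s - b s) / (w - a s)"
    using ws by (simp add: field_simps)
  finally show ?case
    by (simp only: sum.insert[OF insert.hyps(1,2)] news new cong: sum.cong)
      (simp only: distrib_left add_divide_distrib mult_1_right times_divide_eq_left add_ac)
qed

definition qpoch :: "'a::comm_ring_1 \<Rightarrow> 'a \<Rightarrow> nat \<Rightarrow> 'a" where
  "qpoch a q n = (\<Prod>j<n. 1 - a * q ^ j)"

text \<open>
  Cutting an index range at \<open>m\<close> and counting both pieces outwards from the cut turns a product over a range into
  two finite \<open>q\<close>-Pochhammer symbols.
\<close>

lemma prod_lessThan_add_reverse: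
  "(\<Prod>j<m + n. f j) = (\<Prod>j<m. f (m - Suc j)) * (\<Prod>j<n. f (m + j) :: 'a::comm_monoid_mult)"
proof -
  have "(\<Prod>j<m + n. f j) = (\<Prod>j<m. f j) * (\<Prod>j<n. f (m + j))"
    by (induction n) (simp_all add: mult_ac)
  thus ?thesis by (simp add: prod.nat_diff_reindex)
qed

lemma sum_lessThan_add_reverse:
  "(\<Sum>j<m + n. f j) = (\<Sum>j<m. f (m - Suc j)) + (\<Sum>j<n. f (m + j) :: 'a::comm_monoid_add)"
proof -
  have "(\<Sum>j<m + n. f j) = (\<Sum>j<m. f j) + (\<Sum>j<n. f (m + j))"
    by (induction n) (simp_all add: add_ac)
  thus ?thesis by (simp add: sum.nat_diff_reindex)
qed

lemma diff_mult_self: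
  fixes p q :: "'a::comm_ring_1"
  shows "p * q - p = - p * (1 - q)" and "p - p * q = p * (1 - q)"
  by (simp_all add: algebra_simps)

text \<open>
  The poles below are \<open>x^(2 j + 2)\<close> and the zeros \<open>x^(2 j + 1)\<close>, so the residue at the \<open>i\<close>-th pole is the quotient of
  this product and the next one. Both are written with the same last factor, which therefore cancels and leaves
  the monomial \<open>- x^(i + 1)\<close> and \<open>q\<close>-Pochhammer symbols counted outwards from \<open>i\<close>.
\<close>

lemma prod_residue_numerator:
  fixes x :: "'a::comm_ring_1"
  shows "(\<Prod>j<Suc (i + n). x ^ (2 * i + 2) - x ^ (2 * j + 1))
      = - (x ^ (i + 1)) * qpoch x (x^2) (Suc i) * qpoch x (x^2) n
        * ((\<Prod>j<i. - (x ^ (2 * j + 2))) * x ^ ((2 * i + 2) * n))"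
proof -
  have low: "(\<Prod>j<Suc i. x ^ (2 * i + 2) - x ^ (2 * (Suc i - Suc j) + 1))
      = (\<Prod>j<Suc i. - (x ^ (2 * (Suc i - Suc j) + 1))) * qpoch x (x^2) (Suc i)"
    unfolding qpoch_def prod.distrib[symmetric]
  proof (rule prod.cong)
    fix j assume "j \<in> {..<Suc i}"
    then obtain e where "i = j + e" by (auto simp: less_Suc_eq_le le_iff_add)
    hence "x ^ (2 * i + 2) = x ^ (2 * (Suc i - Suc j) + 1) * (x * (x\<^sup>2) ^ j)"
      by (simp add: power_add power_mult power_mult_distrib power2_eq_square mult_ac)
    thus "x ^ (2 * i + 2) - x ^ (2 * (Suc i - Suc j) + 1)
       = - (x ^ (2 * (Suc i - Suc j) + 1)) * (1 - x * (x\<^sup>2) ^ j)"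
      by (simp only: diff_mult_self)
  qed simp
  have high: "(\<Prod>j<n. x ^ (2 * i + 2) - x ^ (2 * (Suc i + j) + 1))
      = x ^ ((2 * i + 2) * n) * qpoch x (x^2) n"
  proof -
    have "(\<Prod>j<n. x ^ (2 * i + 2) - x ^ (2 * (Suc i + j) + 1))
       = (\<Prod>j<n. x ^ (2 * i + 2) * (1 - x * (x\<^sup>2) ^ j))"
      unfolding diff_mult_self(2)[symmetric] by (intro prod.cong refl)
         (simp add: power_add power_mult power_mult_distrib power2_eq_square mult_ac)
    thus ?thesis by (simp only: prod.distrib prod_constant card_lessThan qpoch_def power_mult)
  qed
  have "(\<Prod>j<Suc i. - (x ^ (2 * (Suc i - Suc j) + 1))) = (\<Prod>j<Suc i. - (x ^ (2 * j + 1)))"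
    by (rule prod.nat_diff_reindex[of "\<lambda>j. - (x ^ (2 * j + 1))"])
  also have "\<dots> = - (x ^ (i + 1)) * (\<Prod>j<i. - (x ^ (2 * j + 2)))"
  proof (induction i)
    case (Suc i)
    show ?case by (subst prod.lessThan_Suc, subst Suc) (simp add: mult_ac)
  qed simp
  finally have pow: "(\<Prod>j<Suc i. - (x ^ (2 * (Suc i - Suc j) + 1)))
      = - (x ^ (i + 1)) * (\<Prod>j<i. - (x ^ (2 * j + 2)))" .
  have "(\<Prod>j<Suc (i + n). x ^ (2 * i + 2) - x ^ (2 * j + 1))
      = (\<Prod>j<Suc i + n. x ^ (2 * i + 2) - x ^ (2 * j + 1))"
    by simp
  also have "\<dots> = - (x ^ (i + 1)) * qpoch x (x^2) (Suc i) * qpoch x (x^2) n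
        * ((\<Prod>j<i. - (x ^ (2 * j + 2))) * x ^ ((2 * i + 2) * n))"
    unfolding prod_lessThan_add_reverse low high pow by (simp only: mult_ac)
  finally show ?thesis .
qed

lemma prod_residue_denominator:
  fixes x :: "'a::comm_ring_1"
  shows "(\<Prod>j\<in>{..<Suc (i + n)} - {i}. x ^ (2 * i + 2) - x ^ (2 * j + 2))
      = qpoch (x^2) (x^2) i * qpoch (x^2) (x^2) n
        * ((\<Prod>j<i. - (x ^ (2 * j + 2))) * x ^ ((2 * i + 2) * n))"
proof -
  let ?f = "\<lambda>j. x ^ (2 * i + 2) - x ^ (2 * j + 2)"
  have low: "(\<Prod>j<i. ?f (i - Suc j))
      = (\<Prod>j<i. - (x ^ (2 * j + 2))) * qpoch (x^2) (x^2) i"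
  proof -
    have "(\<Prod>j<i. ?f (i - Suc j))
      = (\<Prod>j<i. - (x ^ (2 * (i - Suc j) + 2)) * (1 - x\<^sup>2 * (x\<^sup>2) ^ j))"
    proof (rule prod.cong)
      fix j assume "j \<in> {..<i}"
      then obtain e where "i = j + Suc e" using less_imp_Suc_add by fastforce
      hence "x ^ (2 * i + 2) = x ^ (2 * (i - Suc j) + 2) * (x\<^sup>2 * (x\<^sup>2) ^ j)"
        by (simp add: power_add power_mult power_mult_distrib power2_eq_square mult_ac)
      thus "?f (i - Suc j) = - (x ^ (2 * (i - Suc j) + 2)) * (1 - x\<^sup>2 * (x\<^sup>2) ^ j)"
        by (simp only: diff_mult_self)
    qed simp
    moreover have "(\<Prod>j<i. - (x ^ (2 * (i - Suc j) + 2))) = (\<Prod>j<i. - (x ^ (2 * j + 2)))"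
      by (rule prod.nat_diff_reindex[of "\<lambda>j. - (x ^ (2 * j + 2))"])
    ultimately show ?thesis by (simp only: prod.distrib qpoch_def)
  qed
  have high: "(\<Prod>j<n. ?f (Suc i + j)) = x ^ ((2 * i + 2) * n) * qpoch (x^2) (x^2) n"
  proof -
    have "(\<Prod>j<n. ?f (Suc i + j)) = (\<Prod>j<n. x ^ (2 * i + 2) * (1 - x\<^sup>2 * (x\<^sup>2) ^ j))"
      unfolding diff_mult_self(2)[symmetric] by (intro prod.cong refl)
         (simp add: power_add power_mult power_mult_distrib power2_eq_square mult_ac)
    thus ?thesis by (simp only: prod.distrib prod_constant card_lessThan qpoch_def power_mult)
  qed
  have S: "{..<Suc (i + n)} - {i} = {..<i} \<union> {Suc i..<Suc i + n}" by auto
  have "(\<Prod>j\<in>{..<Suc (i + n)} - {i}. ?f j) = (\<Prod>j<i. ?f j) * (\<Prod>j\<in>{Suc i..<Suc i + n}. ?f j)"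
    by (subst S) (rule prod.union_disjoint, auto)
  also have "(\<Prod>j<i. ?f j) = (\<Prod>j<i. ?f (i - Suc j))"
    by (rule prod.nat_diff_reindex[of ?f, symmetric])
  also have "(\<Prod>j\<in>{Suc i..<Suc i + n}. ?f j) = (\<Prod>j<n. ?f (Suc i + j))"
    by (rule prod.reindex_bij_witness[of _ "\<lambda>j. Suc i + j" "\<lambda>j. j - Suc i"]) auto
  finally show ?thesis unfolding low high by (simp only: mult_ac)
qed

text \<open>
  Partial fractions with \<open>2 N\<close> poles \<open>x^(2 j + 2)\<close> and \<open>2 N\<close> zeros \<open>x^(2 j + 1)\<close>, evaluated at \<open>w = z x^(2 N)\<close>.
  With this \<open>w\<close> the middle of the range becomes the centre of the bilateral sum: the poles with index below \<open>N\<close>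
  give the factors \<open>1 - z x^(2 k)\<close>, and the others the factors \<open>1 - y x^(2 k + 1)\<close>, where \<open>y = x / z\<close>. The lower half
  contributes a factor \<open>x^(-N)\<close>, so everything is multiplied by \<open>x^N\<close>. The constant term of the decomposition then
  turns into \<open>x^N\<close>, which disappears as \<open>N\<close> grows.
\<close>

lemma finite_bilateral_sum:
  fixes x y z :: "'a::field"
  assumes x: "x = z * y" and nz: "x \<noteq> 0"
    and root: "\<And>n. n > 0 \<Longrightarrow> x ^ n \<noteq> 1"
    and dz: "\<And>k. z * x ^ (2 * k) \<noteq> 1" and dy: "\<And>k. y * x ^ (2 * k + 1) \<noteq> 1"
  shows "qpoch (z * x) (x^2) N * qpoch y (x^2) N / (qpoch z (x^2) N * qpoch (x * y) (x^2) N)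
    = x ^ N + (\<Sum>k<N. x ^ k *
        (qpoch x (x^2) (N - k) * qpoch x (x^2) (N + k)
           / (qpoch (x^2) (x^2) (N - Suc k) * qpoch (x^2) (x^2) (N + k)) / (1 - z * x ^ (2 * k))
         - y * (qpoch x (x^2) (N + Suc k) * qpoch x (x^2) (N - Suc k)
           / (qpoch (x^2) (x^2) (N + k) * qpoch (x^2) (x^2) (N - Suc k)) / (1 - y * x ^ (2 * k + 1)))))"
proof -
  define a where "a = (\<lambda>j::nat. x ^ (2 * j + 2))"
  define b where "b = (\<lambda>j::nat. x ^ (2 * j + 1))"
  define w where "w = z * x ^ (2 * N)"
  define C where "C = (\<lambda>i n. qpoch x (x^2) (Suc i) * qpoch x (x^2) n
                     / (qpoch (x^2) (x^2) i * qpoch (x^2) (x^2) n))"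
  have zy: "z \<noteq> 0" "y \<noteq> 0" using x nz by auto
  have low_a: "w - a (N - Suc k) = - (x ^ (2 * (N - Suc k) + 2)) * (1 - z * x ^ (2 * k))"
    and low_b: "w - b (N - Suc k) = - (x ^ (2 * (N - Suc k) + 1)) * (1 - z * x * (x^2) ^ k)"
    if "k < N" for k
  proof -
    obtain e where "N = k + Suc e" using less_imp_Suc_add[OF \<open>k < N\<close>] by auto
    hence w1: "w = x ^ (2 * (N - Suc k) + 2) * (z * x ^ (2 * k))"
      and w2: "w = x ^ (2 * (N - Suc k) + 1) * (z * x * (x^2) ^ k)"
      by (simp_all add: w_def power_add power_mult power_mult_distrib power2_eq_square mult_ac)
    show "w - a (N - Suc k) = - (x ^ (2 * (N - Suc k) + 2)) * (1 - z * x ^ (2 * k))"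
      by (simp only: a_def w1 diff_mult_self)
    show "w - b (N - Suc k) = - (x ^ (2 * (N - Suc k) + 1)) * (1 - z * x * (x^2) ^ k)"
      by (simp only: b_def w2 diff_mult_self)
  qed
  have high_a: "w - a (N + k) = z * x ^ (2 * N) * (1 - y * x ^ (2 * k + 1))"
    and high_b: "w - b (N + k) = z * x ^ (2 * N) * (1 - y * (x^2) ^ k)" for k
  proof -
    have "a (N + k) = x ^ (2 * N) * (x * x ^ (2 * k + 1))" "b (N + k) = x ^ (2 * N) * (x * x ^ (2 * k))"
      by (simp_all add: a_def b_def power_add algebra_simps)
    thus "w - a (N + k) = z * x ^ (2 * N) * (1 - y * x ^ (2 * k + 1))"
      "w - b (N + k) = z * x ^ (2 * N) * (1 - y * (x^2) ^ k)"
      unfolding w_def power_mult[symmetric] using x by (simp_all add: right_diff_distrib mult_ac)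
  qed
  have wa: "w \<noteq> a j" if "j < 2 * N" for j
  proof (cases "j < N")
    case True
    hence "w - a (N - Suc (N - Suc j)) \<noteq> 0"
      using dz[of "N - Suc j"] nz by (subst low_a) auto
    thus ?thesis using True by simp
  next
    case False
    hence "w - a (N + (j - N)) \<noteq> 0"
      using dy[of "j - N"] nz zy by (subst high_a) auto
    thus ?thesis using False by simp
  qed
  have inj: "inj_on a {..<2 * N}"
  proof (rule linorder_inj_onI)
    fix i j :: nat assume "i < j"
    then obtain d where d: "j = i + Suc d" using less_imp_Suc_add by auto
    show "a i \<noteq> a j"
    proof
      assume "a i = a j"
      hence "x ^ (2 * i + 2) * 1 = x ^ (2 * i + 2) * x ^ (2 * Suc d)"
        by (simp add: a_def d power_add[symmetric] algebra_simps)
      hence "x ^ (2 * Suc d) = 1" using nz by (subst (asm) mult_left_cancel) auto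
      thus False using root[of "2 * Suc d"] by simp
    qed
  qed auto
  have res: "(\<Prod>j<2 * N. a i - b j) / (\<Prod>j\<in>{..<2 * N} - {i}. a i - a j)
      = - (x ^ (i + 1)) * C i (2 * N - Suc i)" if "i < 2 * N" for i
  proof -
    define n where "n = 2 * N - Suc i"
    have N: "2 * N = Suc (i + n)" using that by (simp add: n_def)
    have "(\<Prod>j<i. - (x ^ (2 * j + 2))) * x ^ ((2 * i + 2) * n) \<noteq> 0"
      using nz by (auto simp: prod_zero_iff)
    thus ?thesis
      unfolding n_def[symmetric] a_def b_def C_def N prod_residue_numerator prod_residue_denominator
      by (simp del: power_Suc mult_Suc mult_Suc_right)
  qed
  have lhs: "x ^ N * (\<Prod>j<2 * N. (w - b j) / (w - a j)) =
     qpoch (z * x) (x^2) N * qpoch y (x^2) N / (qpoch z (x^2) N * qpoch (x * y) (x^2) N)"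
  proof -
    have "(\<Prod>j<N. (w - b (N - Suc j)) / (w - a (N - Suc j)))
       = (\<Prod>j<N. (1 / x) * ((1 - z * x * (x^2) ^ j) / (1 - z * (x^2) ^ j)))"
    proof (rule prod.cong)
      fix j assume "j \<in> {..<N}"
      thus "(w - b (N - Suc j)) / (w - a (N - Suc j))
        = (1 / x) * ((1 - z * x * (x^2) ^ j) / (1 - z * (x^2) ^ j))"
        using nz dz[of j] by (simp add: low_a low_b power_mult[of x 2, symmetric])
    qed simp
    also have "\<dots> = (1 / x) ^ N * (qpoch (z * x) (x^2) N / qpoch z (x^2) N)"
      by (simp only: prod.distrib prod_constant card_lessThan prod_dividef qpoch_def)
    finally have 1: "(\<Prod>j<N. (w - b (N - Suc j)) / (w - a (N - Suc j)))
      = (1 / x) ^ N * (qpoch (z * x) (x^2) N / qpoch z (x^2) N)" .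
    have "(\<Prod>j<N. (w - b (N + j)) / (w - a (N + j)))
       = (\<Prod>j<N. (1 - y * (x^2) ^ j) / (1 - x * y * (x^2) ^ j))"
      using nz zy by (intro prod.cong refl)
         (simp add: high_a high_b power_mult[of x 2, symmetric] mult_ac)
    also have "\<dots> = qpoch y (x^2) N / qpoch (x * y) (x^2) N"
      by (simp only: prod_dividef qpoch_def)
    finally have 2: "(\<Prod>j<N. (w - b (N + j)) / (w - a (N + j)))
      = qpoch y (x^2) N / qpoch (x * y) (x^2) N" .
    show ?thesis
      using nz unfolding mult_2 prod_lessThan_add_reverse 1 2 by (simp add: power_one_over)
  qed
  have div: "p / s = r" if "p = r * s" "s \<noteq> 0" for p r s :: 'a
    using that by simp
  have low: "x ^ N * (- (x ^ (N - Suc k + 1)) * C (N - Suc k) (N + k) / (w - a (N - Suc k)))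
     = x ^ k * (C (N - Suc k) (N + k) / (1 - z * x ^ (2 * k)))" if "k < N" for k
  proof -
    obtain e where e: "N = k + Suc e" using less_imp_Suc_add[OF \<open>k < N\<close>] by auto
    have "x ^ N * x ^ (N - Suc k + 1) = x ^ k * x ^ (2 * (N - Suc k) + 2)"
      by (simp add: e power_add[symmetric] mult_2 add.assoc)
    hence "x ^ N * x ^ (N - Suc k + 1) / x ^ (2 * (N - Suc k) + 2) = x ^ k"
      by (rule div) (rule power_not_zero[OF nz])
    moreover have "p * (- q * c / (- s * d)) = (p * q / s) * (c / d)" for p q c s d :: 'a
      by simp
    ultimately show ?thesis unfolding low_a[OF that] by (simp only:)
  qed
  have high: "x ^ N * (- (x ^ (N + k + 1)) * C (N + k) (N - Suc k) / (w - a (N + k)))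
     = - (x ^ k * (y * (C (N + k) (N - Suc k) / (1 - y * x ^ (2 * k + 1)))))" for k
  proof -
    have "x ^ N * x ^ (N + k + 1) = x ^ k * y * (z * x ^ (2 * N))"
      by (simp add: power_add mult_2 x)
    hence "x ^ N * x ^ (N + k + 1) / (z * x ^ (2 * N)) = x ^ k * y"
      by (rule div) (use nz zy in simp)
    moreover have "p * (- q * c / (s * d)) = - ((p * q / s) * (c / d))" for p q c s d :: 'a
      by simp
    ultimately have "x ^ N * (- (x ^ (N + k + 1)) * C (N + k) (N - Suc k) / (w - a (N + k)))
     = - (x ^ k * y * (C (N + k) (N - Suc k) / (1 - y * x ^ (2 * k + 1))))"
      unfolding high_a by (simp only:)
    thus ?thesis by (simp only: mult.assoc)
  qed
  have "x ^ N * (\<Prod>j<2 * N. (w - b j) / (w - a j)) = x ^ N * (1 + (\<Sum>i<2 * N.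
      (\<Prod>j<2 * N. a i - b j) / (\<Prod>j\<in>{..<2 * N} - {i}. a i - a j) / (w - a i)))"
    using inj wa by (subst prod_partial_fractions) auto
  also have "\<dots> = x ^ N + (\<Sum>i<2 * N. x ^ N * (- (x ^ (i + 1)) * C i (2 * N - Suc i) / (w - a i)))"
    unfolding distrib_left mult_1_right sum_distrib_left
    by (intro arg_cong2[of _ _ _ _ "(+)"] sum.cong refl) (simp only: res lessThan_iff)
  also have "(\<Sum>i<2 * N. x ^ N * (- (x ^ (i + 1)) * C i (2 * N - Suc i) / (w - a i)))
    = (\<Sum>k<N. x ^ N * (- (x ^ (N - Suc k + 1)) * C (N - Suc k) (N + k) / (w - a (N - Suc k))))
    + (\<Sum>k<N. x ^ N * (- (x ^ (N + k + 1)) * C (N + k) (N - Suc k) / (w - a (N + k))))"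
  proof -
    have "N + N - Suc (N - Suc k) = N + k" "N + N - Suc (N + k) = N - Suc k" if "k < N" for k
      using that by auto
    thus ?thesis unfolding mult_2[of N] sum_lessThan_add_reverse
      by (intro arg_cong2[of _ _ _ _ "(+)"] sum.cong refl) (simp_all only: lessThan_iff)
  qed
  also have "\<dots> = (\<Sum>k<N. x ^ k * (C (N - Suc k) (N + k) / (1 - z * x ^ (2 * k))
      - y * (C (N + k) (N - Suc k) / (1 - y * x ^ (2 * k + 1)))))"
    unfolding sum.distrib[symmetric]
    by (intro sum.cong refl)
       (simp only: low high lessThan_iff right_diff_distrib add_uminus_conv_diff)
  also have "\<dots> = (\<Sum>k<N. x ^ k *
        (qpoch x (x^2) (N - k) * qpoch x (x^2) (N + k)
           / (qpoch (x^2) (x^2) (N - Suc k) * qpoch (x^2) (x^2) (N + k)) / (1 - z * x ^ (2 * k))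
         - y * (qpoch x (x^2) (N + Suc k) * qpoch x (x^2) (N - Suc k)
           / (qpoch (x^2) (x^2) (N + k) * qpoch (x^2) (x^2) (N - Suc k)) / (1 - y * x ^ (2 * k + 1)))))"
    by (intro sum.cong refl) (simp only: C_def lessThan_iff Suc_diff_Suc add_Suc_right)
  finally show ?thesis
    unfolding lhs .
qed

section \<open>The bilateral summation for formal power series\<close>

lemma fps_nth_0_qpoch [simp]:
  "fps_nth a 0 = 0 \<Longrightarrow> fps_nth (qpoch a q n) 0 = (1 :: 'a::comm_ring_1)"
  unfolding qpoch_def by (induction n) simp_all

lemma fps_to_fls_qpoch: "fps_to_fls (qpoch a q n) = qpoch (fps_to_fls a) (fps_to_fls q) n"
  unfolding qpoch_def
  by (induction n) (simp_all add: fls_times_fps_to_fls fps_to_fls_power)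

lemma fps_to_fls_sum: "fps_to_fls (\<Sum>i\<in>A. f i) = (\<Sum>i\<in>A. fps_to_fls (f i))"
  by (induction A rule: infinite_finite_induct) auto

lemma fps_to_fls_inverse:
  fixes f :: "'a::field fps"
  assumes "fps_nth f 0 \<noteq> 0"
  shows "fps_to_fls (inverse f) = inverse (fps_to_fls f)"
  using fls_inverse_fps_to_fls[of f] assms by (simp add: subdegree_eq_0_iff)

text \<open>
  The differences of the poles have constant coefficient 0, so the partial fractions only make sense in the field of
  Laurent series. The resulting identity only inverts series with constant coefficient 1 and hence descends to
  power series.
\<close>

lemma finite_bilateral_sum_fps:
  fixes x y z :: "'a::field fps"
  assumes x: "x = z * y" and "z \<noteq> 0" "y \<noteq> 0" "fps_nth z 0 = 0" "fps_nth y 0 = 0"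
  shows "qpoch (z * x) (x^2) N * qpoch y (x^2) N * inverse (qpoch z (x^2) N * qpoch (x * y) (x^2) N)
    = x ^ N + (\<Sum>k<N. x ^ k *
        (qpoch x (x^2) (N - k) * qpoch x (x^2) (N + k)
           * inverse (qpoch (x^2) (x^2) (N - Suc k) * qpoch (x^2) (x^2) (N + k))
           * inverse (1 - z * x ^ (2 * k))
         - y * (qpoch x (x^2) (N + Suc k) * qpoch x (x^2) (N - Suc k)
           * inverse (qpoch (x^2) (x^2) (N + k) * qpoch (x^2) (x^2) (N - Suc k))
           * inverse (1 - y * x ^ (2 * k + 1)))))"
proof -
  let ?h = "fps_to_fls"
  have x0: "fps_nth x 0 = 0" "x \<noteq> 0" using assms by auto
  have ne1: "?h f \<noteq> 1" if "fps_nth f 0 = 0" for f :: "'a fps"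
    using that by (auto simp: fps_to_fls_eq_1_iff)
  have inv: "?h (inverse (1 - z * f)) = inverse (1 - ?h z * ?h f)"
    "?h (inverse (1 - y * f)) = inverse (1 - ?h y * ?h f)" for f
    using assms(4,5) by (simp_all add: fps_to_fls_inverse fls_times_fps_to_fls)
  have invq: "?h (inverse (qpoch a q m * qpoch c q n)) = inverse (qpoch (?h a) (?h q) m * qpoch (?h c) (?h q) n)"
    if "fps_nth a 0 = 0" "fps_nth c 0 = 0" for a c q :: "'a fps" and m n
    using that by (simp add: fps_to_fls_inverse fls_times_fps_to_fls fps_to_fls_qpoch)
  have zero: "fps_nth (x^2) 0 = 0" "fps_nth (x * y) 0 = 0"
    using x0 by (simp_all add: power2_eq_square)
  have "?h x = ?h z * ?h y" "?h x \<noteq> 0"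
    using x x0 by (simp_all add: fls_times_fps_to_fls)
  moreover have "?h x ^ n \<noteq> 1" if "n > 0" for n
    using ne1[of "x ^ n"] that x0 by (simp add: fps_to_fls_power)
  moreover have "?h z * ?h x ^ (2 * k) \<noteq> 1" "?h y * ?h x ^ (2 * k + 1) \<noteq> 1" for k
    using ne1[of "z * x ^ (2 * k)"] ne1[of "y * x ^ (2 * k + 1)"] assms(4,5)
    by (simp_all only: fps_to_fls_power fls_times_fps_to_fls fps_mult_nth_0 mult_zero_left simp_thms)
  ultimately have "?h (qpoch (z * x) (x^2) N * qpoch y (x^2) N
      * inverse (qpoch z (x^2) N * qpoch (x * y) (x^2) N)) = ?h (x ^ N + (\<Sum>k<N. x ^ k *
        (qpoch x (x^2) (N - k) * qpoch x (x^2) (N + k)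
           * inverse (qpoch (x^2) (x^2) (N - Suc k) * qpoch (x^2) (x^2) (N + k))
           * inverse (1 - z * x ^ (2 * k))
         - y * (qpoch x (x^2) (N + Suc k) * qpoch x (x^2) (N - Suc k)
           * inverse (qpoch (x^2) (x^2) (N + k) * qpoch (x^2) (x^2) (N - Suc k))
           * inverse (1 - y * x ^ (2 * k + 1))))))"
    unfolding fps_to_fls_plus fps_to_fls_sum fls_times_fps_to_fls fps_to_fls_minus
      inv invq[OF assms(4) zero(2)] invq[OF zero(1) zero(1)] fps_to_fls_power fps_to_fls_qpoch
      fls_times_fps_to_fls divide_inverse[symmetric]
    by (rule finite_bilateral_sum)
  thus ?thesis by (rule fps_to_fls_eq_imp_fps_eq)
qed

lemma tendsto_mult_fps:
  fixes f g :: "'b \<Rightarrow> 'a::ring fps"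
  assumes "(f \<longlongrightarrow> F) net" "(g \<longlongrightarrow> G) net"
  shows "((\<lambda>x. f x * g x) \<longlongrightarrow> F * G) net"
proof (rule tendsto_fpsI)
  fix n
  have "eventually (\<lambda>x. \<forall>i\<in>{0..n}. fps_nth (f x) i = fps_nth F i \<and> fps_nth (g x) i = fps_nth G i) net"
    using assms by (intro eventually_ball_finite) (auto simp: tendsto_fps_iff intro: eventually_conj)
  thus "eventually (\<lambda>x. fps_nth (f x * g x) n = fps_nth (F * G) n) net"
    by eventually_elim (auto simp: fps_mult_nth intro!: sum.cong)
qed

lemma tendsto_diff_fps:
  fixes f g :: "'b \<Rightarrow> 'a::ring fps"
  assumes "(f \<longlongrightarrow> F) net" "(g \<longlongrightarrow> G) net"
  shows "((\<lambda>x. f x - g x) \<longlongrightarrow> F - G) net"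
  unfolding tendsto_fps_iff
proof
  fix n
  have "eventually (\<lambda>x. fps_nth (f x) n = fps_nth F n) net" "eventually (\<lambda>x. fps_nth (g x) n = fps_nth G n) net"
    using assms by (auto simp: tendsto_fps_iff)
  thus "eventually (\<lambda>x. fps_nth (f x - g x) n = fps_nth (F - G) n) net"
    by eventually_elim simp
qed

lemma qpoch_fps_X_tendsto:
  assumes "r > 0" "m > 0"
  shows "qpoch (fps_X ^ r) (fps_X ^ m) \<longlonglongrightarrow> (qpoch_inf (fps_X ^ r) (fps_X ^ m) :: complex fps)"
  using has_prod_imp_tendsto'[OF has_prod_qpoch_inf_fps_X(1)[OF assms]]
  unfolding qpoch_def[abs_def] .

text \<open>
  For fixed \<open>k\<close> the weights in the finite identity tend to \<open>W\<close>. The factor \<open>x^k\<close> keeps the summands with \<open>k > n\<close> away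
  from the \<open>n\<close>-th coefficient, uniformly in \<open>N\<close>, so only finitely many limits are needed. For the same reason
  the infinite sum can be cut off at \<open>n\<close>.
\<close>

lemma nth_bilateral_sum:
  fixes x y z :: "complex fps"
  assumes bM: "0 < b" "b < M"
  defines "x \<equiv> fps_X ^ M" and "z \<equiv> fps_X ^ b" and "y \<equiv> fps_X ^ (M - b)"
  defines "W \<equiv> qpoch_inf x (x\<^sup>2) * qpoch_inf x (x\<^sup>2)
                  * inverse (qpoch_inf (x\<^sup>2) (x\<^sup>2) * qpoch_inf (x\<^sup>2) (x\<^sup>2))"
  shows "fps_nth (qpoch_inf (z * x) (x\<^sup>2) * qpoch_inf y (x\<^sup>2)
           * inverse (qpoch_inf z (x\<^sup>2) * qpoch_inf (x * y) (x\<^sup>2))) n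
    = fps_nth (W * (\<Sum>k\<le>n. x ^ k * (inverse (1 - z * x ^ (2 * k))
                                - y * inverse (1 - y * x ^ (2 * k + 1))))) n"
proof -
  define F where "F = (\<lambda>N. qpoch (z * x) (x\<^sup>2) N * qpoch y (x\<^sup>2) N
           * inverse (qpoch z (x\<^sup>2) N * qpoch (x * y) (x\<^sup>2) N))"
  define T where "T = (\<lambda>k N. x ^ k *
        (qpoch x (x^2) (N - k) * qpoch x (x^2) (N + k)
           * inverse (qpoch (x^2) (x^2) (N - Suc k) * qpoch (x^2) (x^2) (N + k))
           * inverse (1 - z * x ^ (2 * k))
         - y * (qpoch x (x^2) (N + Suc k) * qpoch x (x^2) (N - Suc k)
           * inverse (qpoch (x^2) (x^2) (N + k) * qpoch (x^2) (x^2) (N - Suc k))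
           * inverse (1 - y * x ^ (2 * k + 1)))))"
  define T' where "T' = (\<lambda>k. x ^ k * (W * inverse (1 - z * x ^ (2 * k))
                               - y * (W * inverse (1 - y * x ^ (2 * k + 1)))))"
  have x2: "x\<^sup>2 = fps_X ^ (2 * M)" by (simp add: x_def power_mult mult.commute)
  have zx: "z * x = fps_X ^ (b + M)" "x * y = fps_X ^ (M + (M - b))"
    by (simp_all add: x_def y_def z_def power_add)
  have lim: "qpoch a (x\<^sup>2) \<longlonglongrightarrow> qpoch_inf a (x\<^sup>2)" "fps_nth (qpoch_inf a (x\<^sup>2)) 0 = 1"
    if "a \<in> {x, x\<^sup>2, z, y, z * x, x * y}" for a
  proof -
    have "a \<in> (\<lambda>r. fps_X ^ r) ` {M, 2 * M, b, M - b, b + M, M + (M - b)}"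
      using that unfolding zx x2 unfolding x_def y_def z_def image_insert image_empty .
    then obtain r where "a = fps_X ^ r" "r > 0" using bM by auto
    thus "qpoch a (x\<^sup>2) \<longlonglongrightarrow> qpoch_inf a (x\<^sup>2)" "fps_nth (qpoch_inf a (x\<^sup>2)) 0 = 1"
      using qpoch_fps_X_tendsto[of r "2 * M"] has_prod_qpoch_inf_fps_X(2)[of r "2 * M"] bM
      by (simp_all add: x2)
  qed
  have F: "F \<longlonglongrightarrow> qpoch_inf (z * x) (x\<^sup>2) * qpoch_inf y (x\<^sup>2)
           * inverse (qpoch_inf z (x\<^sup>2) * qpoch_inf (x * y) (x\<^sup>2))"
    unfolding F_def by (intro tendsto_mult_fps tendsto_inverse_fps lim) (simp_all add: lim)
  have weights: "(\<lambda>N. qpoch x (x^2) (f N) * qpoch x (x^2) (g N)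
      * inverse (qpoch (x^2) (x^2) (f' N) * qpoch (x^2) (x^2) (g' N))) \<longlonglongrightarrow> W"
    if "filterlim f at_top sequentially" "filterlim g at_top sequentially"
       "filterlim f' at_top sequentially" "filterlim g' at_top sequentially" for f g f' g'
    unfolding W_def
    by (intro tendsto_mult_fps tendsto_inverse_fps filterlim_compose[OF lim(1)] that) (simp_all add: lim)
  have shift: "filterlim (\<lambda>N. N + k) at_top sequentially" "filterlim (\<lambda>N. N - k) at_top sequentially"
    for k :: nat
    by (rule filterlim_add_const_nat_at_top, rule filterlim_minus_const_nat_at_top)
  have T: "T k \<longlonglongrightarrow> T' k" for k
    unfolding T_def T'_def
    by (intro tendsto_mult_fps[OF tendsto_const] tendsto_diff_fps
          tendsto_mult_fps[OF weights tendsto_const] shift)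
  have "eventually (\<lambda>N. \<forall>k\<in>{..n}. fps_nth (T k N) n = fps_nth (T' k) n) sequentially"
    using T by (intro eventually_ball_finite) (auto simp: tendsto_fps_iff)
  moreover have "eventually (\<lambda>N. fps_nth (F N) n = fps_nth (qpoch_inf (z * x) (x\<^sup>2) * qpoch_inf y (x\<^sup>2)
           * inverse (qpoch_inf z (x\<^sup>2) * qpoch_inf (x * y) (x\<^sup>2))) n) sequentially"
    using F by (auto simp: tendsto_fps_iff)
  moreover have "eventually (\<lambda>N. N > n) sequentially" by (rule eventually_gt_at_top)
  ultimately have "eventually (\<lambda>N. fps_nth (qpoch_inf (z * x) (x\<^sup>2) * qpoch_inf y (x\<^sup>2)
           * inverse (qpoch_inf z (x\<^sup>2) * qpoch_inf (x * y) (x\<^sup>2))) n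
       = (\<Sum>k\<le>n. fps_nth (T' k) n)) sequentially"
  proof eventually_elim
    case (elim N)
    have high: "fps_nth (x ^ k * f) n = 0" if "k > n" for k f
    proof -
      have "n < M * k" using that bM less_le_trans[of n k "M * k"] by simp
      thus ?thesis by (simp add: x_def fps_X_power_mult_nth flip: power_mult)
    qed
    have xN: "fps_nth (x ^ N) n = 0"
      using high[of N 1] elim by simp
    have "F N = x ^ N + (\<Sum>k<N. T k N)"
      unfolding F_def T_def using bM
      by (intro finite_bilateral_sum_fps) (auto simp: x_def y_def z_def simp flip: power_add)
    hence "fps_nth (F N) n = (\<Sum>k<N. fps_nth (T k N) n)"
      by (simp add: fps_sum_nth xN)
    also have "\<dots> = (\<Sum>k\<le>n. fps_nth (T k N) n)"
      using elim by (intro sum.mono_neutral_right) (auto simp: T_def high)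
    finally show ?case using elim by simp
  qed
  hence "fps_nth (qpoch_inf (z * x) (x\<^sup>2) * qpoch_inf y (x\<^sup>2)
           * inverse (qpoch_inf z (x\<^sup>2) * qpoch_inf (x * y) (x\<^sup>2))) n
       = fps_nth (\<Sum>k\<le>n. T' k) n"
    by (simp add: fps_sum_nth)
  also have "(\<Sum>k\<le>n. T' k) = W * (\<Sum>k\<le>n. x ^ k * (inverse (1 - z * x ^ (2 * k))
                                - y * inverse (1 - y * x ^ (2 * k + 1))))"
    unfolding T'_def sum_distrib_left by (intro sum.cong refl) (simp only: right_diff_distrib mult_ac)
  finally show ?thesis .
qed

section \<open>Power series in a power of the variable\<close>

definition supported_on_multiples :: "nat \<Rightarrow> 'a::zero fps \<Rightarrow> bool" where
  "supported_on_multiples M f \<longleftrightarrow> (\<forall>n. \<not> M dvd n \<longrightarrow> fps_nth f n = 0)"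

lemma supported_on_multiples_mult:
  fixes f g :: "'a::semiring_1 fps"
  assumes "supported_on_multiples M f" "supported_on_multiples M g"
  shows "supported_on_multiples M (f * g)"
  unfolding supported_on_multiples_def
proof (intro allI impI)
  fix n assume n: "\<not> M dvd n"
  have "fps_nth f i * fps_nth g (n - i) = 0" if "i \<le> n" for i
  proof (cases "M dvd i")
    case True
    hence "\<not> M dvd n - i" using n that by (metis dvd_diffD)
    thus ?thesis using assms by (simp add: supported_on_multiples_def)
  qed (use assms in \<open>simp add: supported_on_multiples_def\<close>)
  thus "fps_nth (f * g) n = 0" by (simp add: fps_mult_nth)
qed

text \<open>
  The convolution that makes \<open>f * inverse f\<close> vanish at \<open>n\<close> involves, besides \<open>fps_nth f 0 * fps_nth (inverse f) n\<close>, only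
  coefficients of \<open>inverse f\<close> at smaller indices. Those that are multiplied by a nonzero coefficient of \<open>f\<close> have an
  index congruent to \<open>n\<close> modulo \<open>M\<close>.
\<close>

lemma supported_on_multiples_inverse:
  fixes f :: "'a::field fps"
  assumes "supported_on_multiples M f" "fps_nth f 0 \<noteq> 0"
  shows "supported_on_multiples M (inverse f)"
  unfolding supported_on_multiples_def
proof (intro allI impI)
  fix n assume "\<not> M dvd n"
  thus "fps_nth (inverse f) n = 0"
  proof (induction n rule: less_induct)
    case (less n)
    have n: "n > 0" using less.prems by (cases n) auto
    have "fps_nth f i * fps_nth (inverse f) (n - i) = 0" if "i \<in> {1..n}" for i
    proof (cases "M dvd i")
      case True
      hence "\<not> M dvd n - i" using less.prems that by (metis dvd_diffD atLeastAtMost_iff)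
      thus ?thesis using less.IH[of "n - i"] that n by simp
    qed (use assms in \<open>simp add: supported_on_multiples_def\<close>)
    hence "(\<Sum>i=1..n. fps_nth f i * fps_nth (inverse f) (n - i)) = 0"
      by (intro sum.neutral) blast
    hence "(\<Sum>i=0..n. fps_nth f i * fps_nth (inverse f) (n - i)) = fps_nth f 0 * fps_nth (inverse f) n"
      by (simp add: sum.atLeast_Suc_atMost)
    moreover have "(\<Sum>i=0..n. fps_nth f i * fps_nth (inverse f) (n - i)) = 0"
      using inverse_mult_eq_1'[OF assms(2)] n
      by (simp add: fps_mult_nth[symmetric])
    ultimately show ?case using assms(2) by simp
  qed
qed

lemma supported_on_multiples_qpoch_inf:
  assumes "M dvd r" "M dvd m" "r > 0" "m > 0"
  shows "supported_on_multiples M (qpoch_inf (fps_X ^ r) (fps_X ^ m) :: complex fps)"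
  unfolding supported_on_multiples_def
proof (intro allI impI)
  fix n assume n: "\<not> M dvd n"
  have "supported_on_multiples M (qpoch (fps_X ^ r) (fps_X ^ m) N :: complex fps)" for N
  proof (induction N)
    case (Suc N)
    have "M dvd r + m * N" using assms by simp
    hence "supported_on_multiples M (1 - fps_X ^ (r + m * N) :: complex fps)"
      by (auto simp: supported_on_multiples_def fps_X_power_nth)
    hence "supported_on_multiples M (1 - fps_X ^ r * (fps_X ^ m) ^ N :: complex fps)"
      by (simp only: power_add power_mult)
    with Suc show ?case unfolding qpoch_def by (simp add: supported_on_multiples_mult)
  qed (auto simp: qpoch_def supported_on_multiples_def)
  moreover have "eventually (\<lambda>N. fps_nth (qpoch (fps_X ^ r) (fps_X ^ m) N) n
      = fps_nth (qpoch_inf (fps_X ^ r) (fps_X ^ m) :: complex fps) n) sequentially"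
    using qpoch_fps_X_tendsto[OF assms(3,4)] by (simp add: tendsto_fps_iff)
  ultimately have "eventually (\<lambda>N::nat. fps_nth (qpoch_inf (fps_X ^ r) (fps_X ^ m) :: complex fps) n = 0) sequentially"
    using n by (auto simp: supported_on_multiples_def elim!: eventually_mono)
  thus "fps_nth (qpoch_inf (fps_X ^ r) (fps_X ^ m) :: complex fps) n = 0"
    by simp
qed

section \<open>Cancellation in one residue class\<close>

lemma fps_nth_geometric:
  fixes c d :: nat
  assumes "c > 0"
  shows "fps_nth (fps_X ^ d * inverse (1 - fps_X ^ c)) j = (of_nat (card {m. d + c * m = j}) :: 'a::field)"
proof -
  define G where "G = Abs_fps (\<lambda>n. if c dvd n then 1 else 0 :: 'a)"
  have "G * (1 - fps_X ^ c) = 1"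
  proof (rule fps_ext)
    fix n
    have "fps_nth (G * (1 - fps_X ^ c)) n = fps_nth G n - fps_nth (fps_X ^ c * G) n"
      by (simp add: right_diff_distrib mult.commute)
    also have "\<dots> = fps_nth 1 n"
      using assms by (auto simp: G_def fps_X_power_mult_nth dvd_diff_nat dest: dvd_diffD dvd_imp_le)
    finally show "fps_nth (G * (1 - fps_X ^ c)) n = fps_nth 1 n" .
  qed
  hence G: "inverse (1 - fps_X ^ c) = G"
    by (intro fps_inverse_unique) (simp add: mult.commute)
  have "{m. d + c * m = j} = (if d \<le> j \<and> c dvd j - d then {(j - d) div c} else {})"
    using assms by auto
  thus ?thesis unfolding G by (auto simp: fps_X_power_mult_nth G_def)
qed

text \<open>
  The core of the cancellation: both sides are exponents that occur in the bilateral sum, with opposite signs,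
  and \<open>k\<close> and \<open>l\<close> have exchanged their roles as outer index and as quotient of the geometric index by \<open>M\<close>.
\<close>

lemma swap_exponents:
  fixes u d k l :: nat
  assumes "M = 2 * u + 1 + d"
  shows "M * k + (2 * u + 1 + 2 * M * k) * (M * l + (u + d))
       = M * l + d + (d + M * (2 * l + 1)) * (M * k + u)"
  unfolding assms by (simp add: algebra_simps)

text \<open>
  Coprimality makes the geometric index \<open>m\<close> have a fixed residue modulo \<open>M\<close>, namely \<open>u + d\<close> on the left and \<open>u\<close> on the
  right. The bijection exchanges the outer index with \<open>m div M\<close>. The bound \<open>k \<le> n\<close> follows from
  the equation for \<open>j\<close>, so it is preserved.
\<close>

lemma card_swap_exponents:
  fixes u d M n j :: nat
  assumes M: "M = 2 * u + 1 + d" and cop: "coprime (2 * u + 1) M"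
    and j: "[j = (2 * u + 1) * (u + d)] (mod M)" and jn: "j \<le> n"
  shows "card (SIGMA k:{..n}. {m. M * k + (2 * u + 1 + 2 * M * k) * m = j})
       = card (SIGMA k:{..n}. {m. M * k + d + (d + M * (2 * k + 1)) * m = j})"
    (is "card ?A = card ?B")
proof -
  have Mpos: "M > 0" using M by simp
  have copd: "coprime d M"
  proof -
    have "coprime b' (b' + d) \<longleftrightarrow> coprime d (b' + d)" for b' :: nat
      using gcd_add2[of b' d] gcd_add2[of d b']
      by (simp only: coprime_iff_gcd_eq_1 add.commute gcd.commute)
    thus ?thesis using cop unfolding M by blast
  qed
  have A: "\<exists>l. m = M * l + (u + d)" if "M * k + (2 * u + 1 + 2 * M * k) * m = j" for k m
  proof -
    have "j = (2 * u + 1) * m + M * (k + 2 * k * m)"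
      using that by (simp add: algebra_simps)
    hence "[(2 * u + 1) * m = (2 * u + 1) * (u + d)] (mod M)"
      using j by (simp add: cong_def)
    hence "[m = u + d] (mod M)" using cop by (simp only: cong_mult_lcancel_nat)
    hence "m mod M = u + d" using M by (simp add: cong_def)
    thus ?thesis by (metis mult_div_mod_eq)
  qed
  have B: "\<exists>l. m = M * l + u" if "M * k + d + (d + M * (2 * k + 1)) * m = j" for k m
  proof -
    \<comment> \<open>\<open>d\<close> and \<open>- (2 * u + 1)\<close> agree modulo \<open>M\<close>; adding \<open>d * (u + d)\<close> avoids negative numbers\<close>
    have "j + d * (u + d) = d * (m + 1 + (u + d)) + M * (k + (2 * k + 1) * m)"
      using that by (simp add: algebra_simps)
    hence "[d * (m + 1 + (u + d)) = (2 * u + 1) * (u + d) + d * (u + d)] (mod M)"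
      using cong_add[OF j cong_refl[of "d * (u + d)"]] by (simp add: cong_def)
    also have "(2 * u + 1) * (u + d) + d * (u + d) = M * (u + d)"
      unfolding M by (simp add: algebra_simps)
    finally have "M dvd d * (m + 1 + (u + d))"
      by (simp add: cong_def mod_eq_0_iff_dvd)
    hence "M dvd m + 1 + (u + d)" using copd
      by (metis coprime_commute coprime_dvd_mult_right_iff)
    hence "[m + 1 + (u + d) = M] (mod M)" by (simp add: cong_def mod_eq_0_iff_dvd)
    moreover have "M = u + (1 + (u + d))" using M by simp
    ultimately have "[m + (1 + (u + d)) = u + (1 + (u + d))] (mod M)" by (simp add: add.assoc)
    hence "[m = u] (mod M)" by (simp only: cong_add_rcancel_nat)
    hence "m mod M = u" using M by (simp add: cong_def)
    thus ?thesis by (metis mult_div_mod_eq)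
  qed
  have bound: "k \<le> n" if "M * k + r = j" for k r
  proof -
    have "k \<le> M * k" using Mpos by simp
    thus ?thesis using that jn by linarith
  qed
  have div: "(M * l + u) div M = l" "(M * l + (u + d)) div M = l" for l
  proof -
    have "u < M" "u + d < M" using M by auto
    thus "(M * l + u) div M = l" "(M * l + (u + d)) div M = l" using Mpos by simp_all
  qed
  have "bij_betw (\<lambda>(k, m). (m div M, M * k + u)) ?A ?B"
  proof (rule bij_betw_byWitness[where f' = "\<lambda>(k, m). (m div M, M * k + (u + d))"])
    show "\<forall>p\<in>?A. (\<lambda>(k, m). (m div M, M * k + (u + d))) ((\<lambda>(k, m). (m div M, M * k + u)) p) = p"
      using A div by fastforce
    show "\<forall>p\<in>?B. (\<lambda>(k, m). (m div M, M * k + u)) ((\<lambda>(k, m). (m div M, M * k + (u + d))) p) = p"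
      using B div by fastforce
    show "(\<lambda>(k, m). (m div M, M * k + u)) ` ?A \<subseteq> ?B"
    proof (rule image_subsetI)
      fix p assume "p \<in> ?A"
      then obtain k m where p: "p = (k, m)" and e: "M * k + (2 * u + 1 + 2 * M * k) * m = j"
        by auto
      obtain l where l: "m = M * l + (u + d)" using A[OF e] by blast
      have e': "M * l + d + (d + M * (2 * l + 1)) * (M * k + u) = j"
        using e swap_exponents[OF M, of k l] unfolding l by simp
      moreover have "l \<le> n"
        using e' unfolding add.assoc[of "M * l"] by (rule bound)
      ultimately show "(case p of (k, m) \<Rightarrow> (m div M, M * k + u)) \<in> ?B"
        by (simp only: p l div case_prod_conv mem_Sigma_iff atMost_iff mem_Collect_eq simp_thms)
    qed
    show "(\<lambda>(k, m). (m div M, M * k + (u + d))) ` ?B \<subseteq> ?A"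
    proof (rule image_subsetI)
      fix p assume "p \<in> ?B"
      then obtain k m where p: "p = (k, m)" and e: "M * k + d + (d + M * (2 * k + 1)) * m = j"
        by auto
      obtain l where l: "m = M * l + u" using B[OF e] by blast
      have e': "M * l + (2 * u + 1 + 2 * M * l) * (M * k + (u + d)) = j"
        using e swap_exponents[OF M, of l k] unfolding l by simp
      moreover have "l \<le> n"
        using e' by (rule bound)
      ultimately show "(case p of (k, m) \<Rightarrow> (m div M, M * k + (u + d))) \<in> ?A"
        by (simp only: p l div case_prod_conv mem_Sigma_iff atMost_iff mem_Collect_eq simp_thms)
    qed
  qed
  thus ?thesis by (rule bij_betw_same_card)
qed

lemma nth_lambert_difference_eq_0:
  fixes u d M n j :: nat
  defines "x \<equiv> fps_X ^ M :: 'a::field fps" and "z \<equiv> fps_X ^ (2 * u + 1)" and "y \<equiv> fps_X ^ d"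
  assumes M: "M = 2 * u + 1 + d" and cop: "coprime (2 * u + 1) M"
    and j: "[j = (2 * u + 1) * (u + d)] (mod M)" and jn: "j \<le> n"
  shows "fps_nth (\<Sum>k\<le>n. x ^ k * (inverse (1 - z * x ^ (2 * k)) - y * inverse (1 - y * x ^ (2 * k + 1)))) j = 0"
proof -
  have z: "fps_nth (x ^ k * inverse (1 - z * x ^ (2 * k))) j
      = of_nat (card {m. M * k + (2 * u + 1 + 2 * M * k) * m = j})" for k
  proof -
    have "x ^ k * inverse (1 - z * x ^ (2 * k))
       = fps_X ^ (M * k) * inverse (1 - fps_X ^ (2 * u + 1 + 2 * M * k))"
      unfolding x_def z_def by (simp only: power_add power_mult[symmetric] mult_ac)
    thus ?thesis by (simp only: fps_nth_geometric)
  qed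
  have y: "fps_nth (x ^ k * (y * inverse (1 - y * x ^ (2 * k + 1)))) j
      = of_nat (card {m. M * k + d + (d + M * (2 * k + 1)) * m = j})" for k
  proof -
    have "x ^ k * (y * inverse (1 - y * x ^ (2 * k + 1)))
       = fps_X ^ (M * k + d) * inverse (1 - fps_X ^ (d + M * (2 * k + 1)))"
      unfolding x_def y_def by (simp only: power_add[of _ d] power_add[of _ "M * k"] power_mult mult_ac)
    moreover have "0 < d + M * (2 * k + 1)" using M by simp
    ultimately show ?thesis by (simp only: fps_nth_geometric)
  qed
  have fin: "finite {m. a + c * m = j}" if "c > 0" for a c :: nat
  proof (rule finite_subset)
    have "m \<le> a + c * m" for m using that by (simp add: trans_le_add2)
    thus "{m. a + c * m = j} \<subseteq> {..j}" by auto
  qed simp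
  have pos: "0 < 2 * u + 1 + 2 * M * k" "0 < d + M * (2 * k + 1)" for k using M by simp_all
  have "fps_nth (\<Sum>k\<le>n. x ^ k * (inverse (1 - z * x ^ (2 * k)) - y * inverse (1 - y * x ^ (2 * k + 1)))) j
     = (\<Sum>k\<le>n. of_nat (card {m. M * k + (2 * u + 1 + 2 * M * k) * m = j})
          - of_nat (card {m. M * k + d + (d + M * (2 * k + 1)) * m = j}))"
    by (simp only: fps_sum_nth right_diff_distrib fps_sub_nth y z)
  also have "\<dots> = of_nat (card (SIGMA k:{..n}. {m. M * k + (2 * u + 1 + 2 * M * k) * m = j}))
       - of_nat (card (SIGMA k:{..n}. {m. M * k + d + (d + M * (2 * k + 1)) * m = j}))"
    using fin[OF pos(1)] fin[OF pos(2)] by (simp only: card_SigmaI finite_atMost simp_thms ball_triv of_nat_sum sum_subtractf)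
  finally show ?thesis using card_swap_exponents[OF M cop j jn] by simp
qed

text \<open>
  The infinite products in the factor \<open>W\<close> are series in \<open>x = fps_X ^ M\<close>, so the \<open>n\<close>-th coefficient of the product
  of \<open>W\<close> with the sum \<open>L\<close> only involves coefficients of \<open>L\<close> at indices congruent to \<open>n\<close> modulo \<open>M\<close>, and these vanish.
\<close>

theorem nth_theta_quotient_eq_0:
  fixes u d M n :: nat
  assumes M: "M = 2 * u + 1 + d" and d: "d > 0" and cop: "coprime (2 * u + 1) M"
    and n: "[n = (2 * u + 1) * (u + d)] (mod M)"
  shows "fps_nth (qpoch_inf2 (fps_X ^ d) (fps_X ^ (2 * u + 1 + M)) (fps_X ^ (2 * M))
           / qpoch_inf2 (fps_X ^ (2 * u + 1)) (fps_X ^ (M + d)) (fps_X ^ (2 * M)) :: complex fps) n = 0"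
proof -
  define x :: "complex fps" where "x = fps_X ^ M"
  define L where "L = (\<Sum>k\<le>n. x ^ k * (inverse (1 - fps_X ^ (2 * u + 1) * x ^ (2 * k))
                                - fps_X ^ d * inverse (1 - fps_X ^ d * x ^ (2 * k + 1))))"
  define W where "W = qpoch_inf x (x\<^sup>2) * qpoch_inf x (x\<^sup>2)
                  * inverse (qpoch_inf (x\<^sup>2) (x\<^sup>2) * qpoch_inf (x\<^sup>2) (x\<^sup>2))"
  have b: "0 < 2 * u + 1" "2 * u + 1 < M" "M - (2 * u + 1) = d" "M > 0" using M d by auto
  have x2: "x\<^sup>2 = fps_X ^ (2 * M)" by (simp add: x_def power_mult mult.commute)
  have supp: "supported_on_multiples M W"
  proof -
    have "supported_on_multiples M (qpoch_inf x (x\<^sup>2))"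
      "supported_on_multiples M (qpoch_inf (x\<^sup>2) (x\<^sup>2))"
      "fps_nth (qpoch_inf (x\<^sup>2) (x\<^sup>2)) 0 = 1"
      unfolding x2 unfolding x_def using b
      by (auto intro: supported_on_multiples_qpoch_inf has_prod_qpoch_inf_fps_X(2))
    thus ?thesis unfolding W_def
      by (intro supported_on_multiples_mult supported_on_multiples_inverse) simp_all
  qed
  let ?D = "qpoch_inf2 (fps_X ^ (2 * u + 1)) (fps_X ^ (M + d)) (fps_X ^ (2 * M)) :: complex fps"
  have "fps_nth ?D 0 = 1"
    using b by (simp add: qpoch_inf2_def has_prod_qpoch_inf_fps_X(2) del: power_Suc)
  hence "qpoch_inf2 (fps_X ^ d) (fps_X ^ (2 * u + 1 + M)) (fps_X ^ (2 * M)) / ?D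
      = qpoch_inf2 (fps_X ^ d) (fps_X ^ (2 * u + 1 + M)) (fps_X ^ (2 * M)) * inverse ?D"
    by (intro fps_divide_unit) simp
  hence "fps_nth (qpoch_inf2 (fps_X ^ d) (fps_X ^ (2 * u + 1 + M)) (fps_X ^ (2 * M)) / ?D) n = fps_nth (W * L) n"
    using nth_bilateral_sum[OF b(1,2), of n]
    unfolding b(3) x_def[symmetric] W_def[symmetric] L_def[symmetric]
    unfolding x2 unfolding x_def power_add[symmetric] qpoch_inf2_def by (simp only: mult.commute)
  also have "\<dots> = (\<Sum>i=0..n. fps_nth W i * fps_nth L (n - i))" by (rule fps_mult_nth)
  also have "\<dots> = 0"
  proof (rule sum.neutral, rule ballI)
    fix i assume i: "i \<in> {0..n}"
    show "fps_nth W i * fps_nth L (n - i) = 0"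
    proof (cases "M dvd i")
      case True
      then obtain c where "i = M * c" by (rule dvdE)
      hence "[n - i = n] (mod M)"
        using i by (metis atLeastAtMost_iff cong_def le_add_diff_inverse2 mod_mult_self2)
      hence "[n - i = (2 * u + 1) * (u + d)] (mod M)" using n by (rule cong_trans)
      hence "fps_nth L (n - i) = 0"
        unfolding L_def x_def by (intro nth_lambert_difference_eq_0 M cop) simp_all
      thus ?thesis by simp
    qed (use supp in \<open>simp add: supported_on_multiples_def\<close>)
  qed
  finally show ?thesis .
qed

theorem theorem2p2:
  fixes a b c d e f :: "nat \<Rightarrow> complex" and q :: "complex fps"
  assumes "q = fps_X"
    and "qpoch_inf2 (q ^ 6) (q ^ 20) (q ^ 26) / qpoch_inf2 (q ^ 7) (q ^ 19) (q ^ 26) = Abs_fps a"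
    and "qpoch_inf2 (q ^ 8) (q ^ 18) (q ^ 26) / qpoch_inf2 (q ^ 5) (q ^ 21) (q ^ 26) = Abs_fps b"
    and "qpoch_inf2 (q ^ 4) (q ^ 22) (q ^ 26) / qpoch_inf2 (q ^ 9) (q ^ 17) (q ^ 26) = Abs_fps c"
    and "qpoch_inf2 (q ^ 10) (q ^ 16) (q ^ 26) / qpoch_inf2 (q ^ 3) (q ^ 23) (q ^ 26) = Abs_fps d"
    and "qpoch_inf2 (q ^ 2) (q ^ 24) (q ^ 26) / qpoch_inf2 (q ^ 11) (q ^ 15) (q ^ 26) = Abs_fps e"
    and "qpoch_inf2 (q ^ 12) (q ^ 14) (q ^ 26) / qpoch_inf2 q (q ^ 25) (q ^ 26) = Abs_fps f"
  shows "(\<forall>n. a (13 * n + 11) = 0)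
       \<and> (\<forall>n. b (13 * n + 11) = 0)
       \<and> (\<forall>n. c (13 * n + 7) = 0)
       \<and> (\<forall>n. d (13 * n + 7) = 0)
       \<and> (\<forall>n. e (13 * n + 12) = 0)
       \<and> (\<forall>n. f (13 * n + 12) = 0)"
proof -
  have coprime_13: "coprime k (13::nat)" if "k \<in> {1, 3, 5, 7, 9, 11}" for k
    using that by (auto simp: coprime_iff_gcd_eq_1 gcd_non_0_nat)
  \<comment> \<open>In each case \<open>2 * u + 1\<close> is the smallest exponent in the denominator and \<open>d\<close> the smallest in the numerator.
    The residues 11, 11, 7, 7, 12, 12 are \<open>(2 * u + 1) * (u + d)\<close> modulo 13.\<close>
  have A: "a (13 * n + 11) = 0" for n
    using nth_theta_quotient_eq_0[of 13 3 6 "13 * n + 11"] coprime_13[of 7]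
    by (simp add: assms(2)[unfolded assms(1)] cong_def)
  have B: "b (13 * n + 11) = 0" for n
    using nth_theta_quotient_eq_0[of 13 2 8 "13 * n + 11"] coprime_13[of 5]
    by (simp add: assms(3)[unfolded assms(1)] cong_def)
  have C: "c (13 * n + 7) = 0" for n
    using nth_theta_quotient_eq_0[of 13 4 4 "13 * n + 7"] coprime_13[of 9]
    by (simp add: assms(4)[unfolded assms(1)] cong_def)
  have D: "d (13 * n + 7) = 0" for n
    using nth_theta_quotient_eq_0[of 13 1 10 "13 * n + 7"] coprime_13[of 3]
    by (simp add: assms(5)[unfolded assms(1)] cong_def)
  have E: "e (13 * n + 12) = 0" for n
    using nth_theta_quotient_eq_0[of 13 5 2 "13 * n + 12"] coprime_13[of 11]
    by (simp add: assms(6)[unfolded assms(1)] cong_def)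
  have F: "f (13 * n + 12) = 0" for n
    using nth_theta_quotient_eq_0[of 13 0 12 "13 * n + 12"] coprime_13[of 1]
    by (simp add: assms(7)[unfolded assms(1)] cong_def)
  show ?thesis using A B C D E F by blast
qed

end
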